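(* Let $k>0$ be a constant and let $m$, $n$, $\varphi$ be integers. Consider input streams consisting of $m$ transactions of total size $mk$ (i.e., summed over all transactions, the number of items is $mk$), over $n$ distinct items. Let $s_{\mathrm{max}}$ denote the highest support among $k$-itemsets all of whose items have support at least $\varphi$. Then any algorithm that makes a single pass over the transactions and estimates $s_{\mathrm{max}}$ within a factor $\alpha<2$ with error probability $\delta<1/2$ must use space $\Omega(\min(m,\,n^k,\,(m/\varphi)^k))$ bits in expectation on a worst-case input distribution.
   Context: A transaction is a subset of the item set $\{1,\dots,n\}$; a stream is a sequence of transactions $T_1,\dots,T_m$ read one at a time in a single pass. A $k$-itemset is a set of $k$ items. The support of an item or itemset $X$ is the number of transactions $T_t$ with $X\subseteq T_t$. An algorithm estimates a quantity $y$ within a factor $\alpha$ if it outputs a value $x$ with $y\le x\le \alpha y$ (or equivalently within a multiplicative factor $\alpha$ of $y$); error probability $\delta$ means this fails with probability at most $\delta$ over the algorithm's randomness. Space is measured as the number of bits of memory the algorithm maintains. *)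

theory Defs
  imports "HOL-Probability.Probability"
begin

definition support :: "nat set list \<Rightarrow> nat set \<Rightarrow> nat" where
  "support S X = card {t. t < length S \<and> X \<subseteq> S ! t}"

text \<open>The streams of \<open>m\<close> transactions of total size \<open>m k\<close> over the items \<open>1, \<dots>, n\<close>.
  Individual transactions may have any size, and not every item needs to occur.\<close>

definition inputs :: "nat \<Rightarrow> nat \<Rightarrow> nat \<Rightarrow> nat set list set" where
  "inputs k m n =
     {S. length S = m \<and> (\<forall>T\<in>set S. T \<subseteq> {1..n}) \<and> (\<Sum>T\<leftarrow>S. card T) = m * k}"

definition candidates :: "nat \<Rightarrow> nat \<Rightarrow> nat \<Rightarrow> nat set list \<Rightarrow> nat set set" where
  "candidates k n \<phi> S =
     {X. X \<subseteq> {1..n} \<and> card X = k \<and> (\<forall>i\<in>X. \<phi> \<le> support S {i})}"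

text \<open>Unspecified if there is no candidate itemset; see \<open>estimates\<close> below.\<close>

definition s_max :: "nat \<Rightarrow> nat \<Rightarrow> nat \<Rightarrow> nat set list \<Rightarrow> nat" where
  "s_max k n \<phi> S = Max (support S ` candidates k n \<phi> S)"

text \<open>
  A deterministic single-pass algorithm is given by its initial memory contents, the update of
  the memory when the transaction number \<open>t\<close> is read, and the output computed from the final
  memory. The memory is a bit string of variable length. A randomized algorithm is a probability
  distribution over deterministic ones, that is, an \<open>algorithm pmf\<close>. Neither the random choices
  nor the position \<open>t\<close> occupy memory; as the update may depend on \<open>t\<close>, algorithms that draw fresh
  random bits for every transaction are covered. Nothing is required to be computable or uniform
  in the parameters. All of this only enlarges the class of algorithms to which a space lower
  bound applies.
\<close>

record algorithm =
  mem_init :: "bool list"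
  mem_step :: "nat \<Rightarrow> bool list \<Rightarrow> nat set \<Rightarrow> bool list"
  mem_output :: "bool list \<Rightarrow> real"

primrec memory :: "algorithm \<Rightarrow> nat set list \<Rightarrow> nat \<Rightarrow> bool list" where
  "memory A S 0 = mem_init A"
| "memory A S (Suc t) = mem_step A t (memory A S t) (S ! t)"

definition result :: "algorithm \<Rightarrow> nat set list \<Rightarrow> real" where
  "result A S = mem_output A (memory A S (length S))"

definition bits_used :: "algorithm \<Rightarrow> nat set list \<Rightarrow> nat" where
  "bits_used A S = Max ((\<lambda>t. length (memory A S t)) ` {..length S})"

text \<open>
  The error probability is over the random choices of the algorithm, for every single input.
  No requirement is made on streams for which there is no candidate itemset.
\<close>

definition estimates ::
  "algorithm pmf \<Rightarrow> nat \<Rightarrow> nat \<Rightarrow> nat \<Rightarrow> nat \<Rightarrow> real \<Rightarrow> real \<Rightarrow> bool" where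
  "estimates R k m n \<phi> \<alpha> \<delta> \<longleftrightarrow>
     (\<forall>S\<in>inputs k m n. candidates k n \<phi> S \<noteq> {} \<longrightarrow>
        measure_pmf.prob R
          {A. \<not> (real (s_max k n \<phi> S) \<le> result A S \<and>
                 result A S \<le> \<alpha> * real (s_max k n \<phi> S))} \<le> \<delta>)"

text \<open>A nonnegative integral, since the expectation may be infinite (in which case the Bochner
  integral would be 0).\<close>

definition expected_space :: "algorithm pmf \<Rightarrow> nat set list pmf \<Rightarrow> ennreal" where
  "expected_space R D =
     (\<integral>\<^sup>+S. (\<integral>\<^sup>+A. of_nat (bits_used A S) \<partial>measure_pmf R) \<partial>measure_pmf D)"

end

theory Submission
  imports Defs
begin

text \<open>
  Reduction from the one-way communication problem INDEX. Fix \<open>P\<close> pairs of \<open>k\<close>-itemsets. The first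
  part of the stream encodes a string of \<open>P\<close> bits by containing \<open>r\<close> copies of one set of each pair.
  The second part contains \<open>r\<close> further copies of the first set of the pair \<open>j\<close>, so that \<open>s_max\<close> is at least
  \<open>2 r\<close> if bit \<open>j\<close> is set and at most \<open>r\<close> otherwise. It is filled up with other \<open>k\<close>-itemsets, each
  occurring at most \<open>r\<close> times, which raise the support of the queried items to \<open>\<phi>\<close>. Hence the memory
  after the first part determines, for every \<open>j\<close>, a guess of bit \<open>j\<close> that is wrong with probability
  at most \<open>\<delta>\<close>.

  For the space bound, let \<open>\<ell>\<close> be the length of this memory and \<open>d\<close> the number of wrong guesses for a
  uniformly random string. Summing over memory contents gives
  \<open>E (4\<^sup>-\<^sup>\<ell> exp (- x d)) \<le> 2 ((1 + exp (- x)) / 2)\<^sup>P\<close>, and \<open>1 + u \<le> exp u\<close> turns this into a lower bound on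
  \<open>ln 4 * E \<ell> + x * E d\<close>, which is linear in the error and can therefore be averaged over the
  randomness of the algorithm.
\<close>

subsection \<open>Coding with errors\<close>

text \<open>The \<open>2 ^ l\<close> strings of length \<open>l\<close> together weigh
  \<open>(1/2) ^ l\<close>, and these weights form a geometric series. Memory contents need not form
  a prefix-free code, so weight \<open>1/2\<close> per bit would give no bound independent of
  \<open>T\<close>.\<close>

lemma sum_inverse_power_length_le:
  fixes T :: "bool list set"
  assumes "finite T"
  shows "(\<Sum>s\<in>T. (1/4::real) ^ length s) \<le> 2"
proof -
  define K where "K = Suc (Max (length ` T))"
  let ?L = "\<lambda>l. {s::bool list. length s = l}"
  have fin: "finite (?L l)" for l
    using finite_lists_length_eq[of "UNIV::bool set" l] by simp
  have "T \<subseteq> (\<Union>l<K. ?L l)"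
    using assms by (auto simp: K_def less_Suc_eq_le)
  then have "(\<Sum>s\<in>T. (1/4::real) ^ length s) \<le> (\<Sum>s\<in>(\<Union>l<K. ?L l). (1/4::real) ^ length s)"
    by (intro sum_mono2) (use fin in auto)
  also have "\<dots> = (\<Sum>l<K. \<Sum>s\<in>?L l. (1/4::real) ^ length s)"
    by (rule sum.UNION_disjoint) (use fin in auto)
  also have "\<dots> = (\<Sum>l<K. (1/2::real) ^ l)"
    using card_lists_length_eq[of "UNIV::bool set"]
    by (auto intro!: sum.cong simp flip: power_mult_distrib)
  also have "\<dots> \<le> (\<Sum>l. (1/2::real) ^ l)"
    by (rule sum_le_suminf) (auto simp: summable_geometric)
  also have "\<dots> = 2"
    by (simp add: suminf_geometric)
  finally show ?thesis .
qed

text \<open>The left side is the mean of \<open>exp (- x d)\<close> for one fair bit, with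
  \<open>d\<close> indicating a wrong guess. The quadratic bound on \<open>exp (- x)\<close> follows
  from \<open>exp (- x) \<le> 1 / (1 + x)\<close>.\<close>

lemma half_one_plus_exp_le:
  fixes x :: real
  assumes "0 \<le> x"
  shows "(1 + exp (- x)) / 2 \<le> exp (- (x / 2 - x\<^sup>2 / 2))"
proof -
  have "exp (- x) \<le> 1 / (1 + x)"
    using assms exp_ge_add_one_self[of x] by (simp add: exp_minus field_simps)
  also have "\<dots> \<le> 1 - x + x\<^sup>2"
  proof -
    have "(1 - x + x\<^sup>2) * (1 + x) = 1 + x ^ 3"
      by (simp add: algebra_simps power2_eq_square power3_eq_cube)
    then show ?thesis
      using assms by (simp add: pos_divide_le_eq)
  qed
  finally have "(1 + exp (- x)) / 2 \<le> 1 + (- (x / 2 - x\<^sup>2 / 2))" by simp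
  also have "\<dots> \<le> exp (- (x / 2 - x\<^sup>2 / 2))"
    by (rule exp_ge_add_one_self)
  finally show ?thesis .
qed

text \<open>The exponential of the Hamming distance is a product over positions. At each position
  one value of the bit agrees with \<open>y j\<close> and the other does not, so the factor is
  \<open>1 + exp (- x)\<close> for every guess \<open>y\<close>.\<close>

lemma sum_exp_hamming:
  fixes y :: "nat \<Rightarrow> bool" and x :: real
  shows "(\<Sum>b\<in>{..<P} \<rightarrow>\<^sub>E UNIV. exp (- (x * card {j. j < P \<and> y j \<noteq> b j}))) = (1 + exp (- x)) ^ P"
proof -
  have "exp (- (x * card {j. j < P \<and> y j \<noteq> b j})) = (\<Prod>j<P. if y j \<noteq> b j then exp (- x) else 1)" for b
  proof -
    have "(\<Prod>j<P. if y j \<noteq> b j then exp (- x) else 1) = (\<Prod>j\<in>{j\<in>{..<P}. y j \<noteq> b j}. exp (- x))"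
      by (rule prod.inter_filter[symmetric]) simp
    also have "\<dots> = exp (- (x * card {j. j < P \<and> y j \<noteq> b j}))"
      by (simp add: exp_of_nat_mult[symmetric] mult.commute)
    finally show ?thesis by simp
  qed
  then have "(\<Sum>b\<in>{..<P} \<rightarrow>\<^sub>E UNIV. exp (- (x * card {j. j < P \<and> y j \<noteq> b j})))
      = (\<Sum>b\<in>{..<P} \<rightarrow>\<^sub>E UNIV. \<Prod>j<P. if y j \<noteq> b j then exp (- x) else 1)"
    by simp
  also have "\<dots> = (\<Prod>j<P. \<Sum>c\<in>UNIV. if y j \<noteq> c then exp (- x) else 1)"
    by (rule prod_sum_PiE[symmetric]) auto
  also have "\<dots> = (1 + exp (- x)) ^ P"
  proof -
    have "(\<Sum>c\<in>UNIV. if y j \<noteq> c then exp (- x) else 1) = 1 + exp (- x)" for j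
      by (cases "y j") (simp_all add: UNIV_bool)
    then show ?thesis by simp
  qed
  finally show ?thesis .
qed

text \<open>The guess depends on \<open>b\<close> only through the memory contents. For each fixed
  contents it is one fixed string, to which \<open>sum_exp_hamming\<close> applies.\<close>

lemma average_length_plus_errors:
  fixes P :: nat and mem :: "(nat \<Rightarrow> bool) \<Rightarrow> bool list" and y :: "bool list \<Rightarrow> nat \<Rightarrow> bool" and x :: real
  assumes x: "0 \<le> x"
  defines "B \<equiv> {..<P} \<rightarrow>\<^sub>E (UNIV :: bool set)"
  shows "card B * (P * (x / 2 - x\<^sup>2 / 2) - ln 2)
    \<le> (\<Sum>b\<in>B. ln 4 * length (mem b) + x * card {j. j < P \<and> y (mem b) j \<noteq> b j})"
proof -
  define d where "d s b = card {j. j < P \<and> y s j \<noteq> b j}" for s b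
  \<comment> \<open>The \<open>ln 2\<close> absorbs the factor 2 from
    \<open>sum_inverse_power_length_le\<close>.\<close>
  define a where "a = P * (x / 2 - x\<^sup>2 / 2) - ln 2"
  have finB: "finite B" by (simp add: B_def finite_PiE)
  have cardB: "card B = 2 ^ P" by (simp add: B_def card_PiE)
  have quarter: "exp (- (ln 4 * real l)) = (1/4) ^ l" for l :: nat
    by (metis exp_minus exp_of_nat_mult exp_ln inverse_eq_divide mult.commute
        mult_minus_right power_one_over zero_less_numeral)
  have "(\<Sum>b\<in>B. exp (- (ln 4 * length (mem b) + x * d (mem b) b)))
      = (\<Sum>b\<in>B. (1/4) ^ length (mem b) * exp (- (x * d (mem b) b)))"
    by (simp add: quarter[symmetric] flip: exp_add)
  also have "\<dots> = (\<Sum>s\<in>mem ` B. \<Sum>b\<in>{b\<in>B. mem b = s}. (1/4) ^ length (mem b) * exp (- (x * d (mem b) b)))"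
    by (rule sum.image_gen[OF finB])
  \<comment> \<open>Each fibre of \<open>mem\<close> is enlarged to all of \<open>B\<close>, which
    makes the inner sum the same for every \<open>s\<close>.\<close>
  also have "\<dots> \<le> (\<Sum>s\<in>mem ` B. \<Sum>b\<in>B. (1/4) ^ length s * exp (- (x * d s b)))"
    by (intro sum_mono order_trans[OF eq_refl[OF sum.cong] sum_mono2]) (use finB in auto)
  also have "\<dots> = (\<Sum>s\<in>mem ` B. (1/4) ^ length s) * (1 + exp (- x)) ^ P"
    by (simp only: d_def B_def sum_distrib_left[symmetric] sum_exp_hamming sum_distrib_right)
  also have "\<dots> \<le> 2 * (1 + exp (- x)) ^ P"
    by (intro mult_right_mono sum_inverse_power_length_le)
      (use finB in \<open>auto intro!: zero_le_power add_nonneg_nonneg\<close>)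
  also have "(1 + exp (- x)) ^ P \<le> (2 * exp (- (x / 2 - x\<^sup>2 / 2))) ^ P"
    using half_one_plus_exp_le[OF x] by (intro power_mono) (auto intro: add_nonneg_nonneg)
  also have "2 * (2 * exp (- (x / 2 - x\<^sup>2 / 2))) ^ P = card B * exp (- a)"
  proof -
    have "- a = P * (- (x / 2 - x\<^sup>2 / 2)) + ln 2" by (simp add: a_def algebra_simps)
    then have "exp (- a) = exp (- (x / 2 - x\<^sup>2 / 2)) ^ P * 2"
      by (simp only: exp_add exp_of_nat_mult) simp
    then show ?thesis by (simp add: cardB power_mult_distrib)
  qed
  finally have "(\<Sum>b\<in>B. exp (- (ln 4 * length (mem b) + x * d (mem b) b))) \<le> card B * exp (- a)"
    by simp
  then have up: "(\<Sum>b\<in>B. exp (- (ln 4 * length (mem b) + x * d (mem b) b))) * exp a \<le> card B * exp (- a) * exp a"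
    by (rule mult_right_mono) simp
  have le: "(\<Sum>b\<in>B. exp (a - (ln 4 * length (mem b) + x * d (mem b) b))) \<le> card B"
  proof -
    have "exp (a - v) = exp (- v) * exp a" for v :: real
      by (simp flip: exp_add)
    with up show ?thesis
      by (simp only: sum_distrib_right mult.assoc) (simp flip: exp_add)
  qed
  \<comment> \<open>The ones on the left sum to \<open>card B\<close> and cancel the upper bound
    \<open>le\<close>, which leaves the linear inequality.\<close>
  have "(\<Sum>b\<in>B. 1 + (a - (ln 4 * length (mem b) + x * d (mem b) b)))
      \<le> (\<Sum>b\<in>B. exp (a - (ln 4 * length (mem b) + x * d (mem b) b)))"
    by (intro sum_mono exp_ge_add_one_self)
  then have "(\<Sum>b\<in>B. 1 + (a - (ln 4 * length (mem b) + x * d (mem b) b))) \<le> card B"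
    using le by linarith
  then show ?thesis
    by (simp add: sum.distrib sum_subtractf a_def d_def)
qed

subsection \<open>Space of an algorithm that decides every bit\<close>

text \<open>\<open>memory\<close> is tied to one whole stream. Here the position and the memory at
  the start are free, so different suffixes can be run from the same intermediate memory.\<close>

primrec run :: "algorithm \<Rightarrow> nat \<Rightarrow> bool list \<Rightarrow> nat set list \<Rightarrow> bool list" where
  "run A t s [] = s"
| "run A t s (T # S) = run A (Suc t) (mem_step A t s T) S"

lemma run_append: "run A t s (S @ S') = run A (t + length S) (run A t s S) S'"
  by (induction S arbitrary: t s) auto

lemma memory_eq_run: "t \<le> length S \<Longrightarrow> memory A S t = run A 0 (mem_init A) (take t S)"
  by (induction t) (auto simp: take_Suc_conv_app_nth run_append)

lemma result_append:
  "result A (S @ S') = mem_output A (run A (length S) (run A 0 (mem_init A) S) S')"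
  by (simp add: result_def memory_eq_run run_append)

lemma length_run_le_bits_used: "length (run A 0 (mem_init A) S) \<le> bits_used A (S @ S')"
proof -
  have "length (memory A (S @ S') (length S)) \<le> bits_used A (S @ S')"
    unfolding bits_used_def by (intro Max_ge) auto
  then show ?thesis by (simp add: memory_eq_run)
qed

text \<open>The memory after \<open>pre b\<close> is the message of the INDEX protocol. It does not
  depend on \<open>j\<close>, so running every \<open>suf j\<close> from it yields guesses for all
  bits at once. Only this memory enters the space bound, hence \<open>suf l\<close> is arbitrary on
  the right.\<close>

lemma expected_space_ge:
  fixes P :: nat and pre :: "(nat \<Rightarrow> bool) \<Rightarrow> nat set list" and suf :: "nat \<Rightarrow> nat set list"
  defines "B \<equiv> {..<P} \<rightarrow>\<^sub>E (UNIV :: bool set)"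
  assumes x: "0 \<le> x" and \<alpha>: "\<alpha> < 2" and est: "estimates R k m n \<phi> \<alpha> \<delta>"
    and len: "\<And>b. b \<in> B \<Longrightarrow> length (pre b) = t"
    and inp: "\<And>b j. b \<in> B \<Longrightarrow> j < P \<Longrightarrow> pre b @ suf j \<in> inputs k m n"
    and cand: "\<And>b j. b \<in> B \<Longrightarrow> j < P \<Longrightarrow> candidates k n \<phi> (pre b @ suf j) \<noteq> {}"
    and yes: "\<And>b j. b \<in> B \<Longrightarrow> j < P \<Longrightarrow> b j \<Longrightarrow> 2 * r \<le> s_max k n \<phi> (pre b @ suf j)"
    and no: "\<And>b j. b \<in> B \<Longrightarrow> j < P \<Longrightarrow> \<not> b j \<Longrightarrow> s_max k n \<phi> (pre b @ suf j) \<le> r"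
    and "0 < r" "0 < P"
  shows "ennreal ((P * (x / 2 - x\<^sup>2 / 2 - x * \<delta>) - ln 2) / ln 4)
    \<le> expected_space R (map_pmf (\<lambda>b. pre b @ suf l) (pmf_of_set B))"
proof -
  define bad where "bad b j A \<longleftrightarrow> \<not> (real (s_max k n \<phi> (pre b @ suf j)) \<le> result A (pre b @ suf j) \<and>
      result A (pre b @ suf j) \<le> \<alpha> * real (s_max k n \<phi> (pre b @ suf j)))" for b j A
  define mem where "mem A b = run A 0 (mem_init A) (pre b)" for A b
  \<comment> \<open>The threshold separates correct outputs: they are at least \<open>2 * r\<close>
    if the bit is set, and at most \<open>\<alpha> * r < 2 * r\<close> (or nonpositive)
    otherwise.\<close>
  define y where "y A s j \<longleftrightarrow> 2 * r \<le> mem_output A (run A t s (suf j))" for A s j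
  define a where "a = P * (x / 2 - x\<^sup>2 / 2) - ln 2"
  have finB: "finite B" by (simp add: B_def finite_PiE)
  have neB: "B \<noteq> {}" by (auto simp: B_def PiE_eq_empty_iff)
  have cB: "0 < card B" using finB neB by (simp add: card_gt_0_iff)
  have prob: "measure_pmf.prob R {A. bad b j A} \<le> \<delta>" if "b \<in> B" "j < P" for b j
    using est inp[OF that] cand[OF that] by (auto simp: estimates_def bad_def)
  have \<delta>: "0 \<le> \<delta>"
  proof -
    obtain b where "b \<in> B" using neB by auto
    then show ?thesis using prob[of b 0] \<open>0 < P\<close> by (meson measure_nonneg order_trans)
  qed
  have dec: "bad b j A" if b: "b \<in> B" "j < P" and ne: "y A (mem A b) j \<noteq> b j" for b j A
  proof (rule ccontr)
    assume nb: "\<not> bad b j A"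
    have res: "result A (pre b @ suf j) = mem_output A (run A t (mem A b) (suf j))"
      using len[OF b(1)] by (simp add: result_append mem_def)
    show False
    proof (cases "b j")
      case True
      then show False using yes[OF b] nb ne res by (auto simp: bad_def y_def)
    next
      case False
      have "\<alpha> * real (s_max k n \<phi> (pre b @ suf j)) < 2 * real r"
      \<comment> \<open>A negative \<open>\<alpha>\<close> is allowed, and multiplying by it would
        reverse the bound on \<open>s_max\<close>.\<close>
      proof (cases "0 \<le> \<alpha>")
        case True
        then have "\<alpha> * real (s_max k n \<phi> (pre b @ suf j)) \<le> \<alpha> * real r"
          using no[OF b False] by (intro mult_left_mono) auto
        also have "\<dots> < 2 * real r" using \<alpha> \<open>0 < r\<close> by simp
        finally show ?thesis .
      next
        case False
        then have "\<alpha> * real (s_max k n \<phi> (pre b @ suf j)) \<le> 0" by (simp add: mult_nonpos_nonneg)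
        then show ?thesis using \<open>0 < r\<close> by (simp add: order_le_less_trans)
      qed
      then show False using nb ne res False by (auto simp: bad_def y_def)
    qed
  qed
  \<comment> \<open>The bound holds for each deterministic algorithm. The errors stand on the right,
    so that only sums of nonnegative terms are integrated over \<open>R\<close>.\<close>
  have point: "ennreal (card B * a) \<le> (\<Sum>b\<in>B. ennreal (ln 4) * of_nat (bits_used A (pre b @ suf l)))
      + ennreal x * (\<Sum>b\<in>B. \<Sum>j<P. indicator {A. bad b j A} A)" for A
  proof -
    have "card B * a \<le> (\<Sum>b\<in>B. ln 4 * length (mem A b) + x * card {j. j < P \<and> y A (mem A b) j \<noteq> b j})"
      unfolding a_def B_def by (rule average_length_plus_errors[OF x])
    also have "\<dots> \<le> (\<Sum>b\<in>B. ln 4 * bits_used A (pre b @ suf l) + x * (\<Sum>j<P. indicator {A. bad b j A} A))"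
    proof (intro sum_mono add_mono mult_left_mono)
      fix b assume b: "b \<in> B"
      show "real (length (mem A b)) \<le> real (bits_used A (pre b @ suf l))"
        using length_run_le_bits_used by (simp add: mem_def)
      have "card {j. j < P \<and> y A (mem A b) j \<noteq> b j} \<le> card {j. j < P \<and> bad b j A}"
        by (intro card_mono) (use dec[OF b] in auto)
      also have "real \<dots> = (\<Sum>j<P. indicator {A. bad b j A} A)"
        by (simp add: indicator_def sum.If_cases Int_def conj_commute)
      finally show "real (card {j. j < P \<and> y A (mem A b) j \<noteq> b j}) \<le> (\<Sum>j<P. indicator {A. bad b j A} A)"
        by simp
    qed (use x in auto)
    finally have le: "card B * a \<le> (\<Sum>b\<in>B. ln 4 * bits_used A (pre b @ suf l)) + x * (\<Sum>b\<in>B. \<Sum>j<P. indicator {A. bad b j A} A)"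
      by (simp add: sum.distrib sum_distrib_left)
    have "ennreal (\<dots>) = (\<Sum>b\<in>B. ennreal (ln 4) * of_nat (bits_used A (pre b @ suf l)))
      + ennreal x * (\<Sum>b\<in>B. \<Sum>j<P. indicator {A. bad b j A} A)"
      using x by (subst ennreal_plus)
         (auto intro!: sum_nonneg mult_nonneg_nonneg simp: ennreal_mult' ennreal_of_nat_eq_real_of_nat sum_nonneg
           ennreal_indicator simp flip: sum_ennreal)
    then show ?thesis using le by (metis ennreal_leI)
  qed
  let ?E = "\<lambda>b. \<integral>\<^sup>+A. of_nat (bits_used A (pre b @ suf l)) \<partial>measure_pmf R"
  have "ennreal (card B * a) = (\<integral>\<^sup>+A. ennreal (card B * a) \<partial>measure_pmf R)"
    by simp
  also have "\<dots> \<le> (\<integral>\<^sup>+A. ((\<Sum>b\<in>B. ennreal (ln 4) * of_nat (bits_used A (pre b @ suf l)))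
      + ennreal x * (\<Sum>b\<in>B. \<Sum>j<P. indicator {A. bad b j A} A)) \<partial>measure_pmf R)"
    by (intro nn_integral_mono point)
  also have "\<dots> = ennreal (ln 4) * (\<Sum>b\<in>B. ?E b)
      + ennreal x * (\<Sum>b\<in>B. \<Sum>j<P. emeasure R {A. bad b j A})"
    by (simp add: nn_integral_add nn_integral_sum nn_integral_cmult flip: sum_distrib_left del: sum_indicator_eq_card)
  also have "(\<Sum>b\<in>B. \<Sum>j<P. emeasure R {A. bad b j A}) \<le> (\<Sum>b\<in>B. \<Sum>j<P. ennreal \<delta>)"
    by (intro sum_mono) (use prob in \<open>auto simp: measure_pmf.emeasure_eq_measure intro!: ennreal_leI\<close>)
  also have "\<dots> = ennreal (card B * P * \<delta>)"
    using \<delta> by (simp add: ennreal_mult' ennreal_of_nat_eq_real_of_nat mult.assoc)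
  also have "ennreal x * ennreal (card B * P * \<delta>) = ennreal (card B * (P * x * \<delta>))"
    using x by (simp add: ennreal_mult'[symmetric] mult_ac)
  also have "(\<Sum>b\<in>B. ?E b) = of_nat (card B) * expected_space R (map_pmf (\<lambda>b. pre b @ suf l) (pmf_of_set B))"
    using finB neB cB
  proof -
    have "expected_space R (map_pmf (\<lambda>b. pre b @ suf l) (pmf_of_set B)) = (\<Sum>b\<in>B. ?E b) / of_nat (card B)"
      using finB neB by (simp add: expected_space_def nn_integral_pmf_of_set)
    then show ?thesis using cB
      by (simp add: mult_divide_eq_ennreal[of "of_nat (card B)"] mult.commute[of "of_nat (card B)"] ennreal_times_divide)
  qed
  finally have *: "ennreal (card B * a) \<le> ennreal (ln 4) *
      (of_nat (card B) * expected_space R (map_pmf (\<lambda>b. pre b @ suf l) (pmf_of_set B)))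
      + ennreal (card B * (P * x * \<delta>))"
    by (simp add: add_left_mono mult_left_mono)
  let ?X = "expected_space R (map_pmf (\<lambda>b. pre b @ suf l) (pmf_of_set B))"
  show ?thesis
  \<comment> \<open>Infinite expected space is trivial; finite space permits subtracting the error
    term in the reals.\<close>
  proof (cases ?X rule: ennreal_cases)
    case (real e)
    have "ennreal (ln 4) * (of_nat (card B) * ?X) + ennreal (card B * (P * x * \<delta>))
       = ennreal (ln 4 * (card B * e) + card B * (P * x * \<delta>))"
      using real x \<delta> by (subst ennreal_plus) (auto simp: ennreal_mult' ennreal_of_nat_eq_real_of_nat)
    then have "ennreal (card B * a) \<le> ennreal (ln 4 * (card B * e) + card B * (P * x * \<delta>))"
      using * by simp
    then have "card B * a \<le> ln 4 * (card B * e) + card B * (P * x * \<delta>)"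
      using real x \<delta> by (subst (asm) ennreal_le_iff) (auto intro!: add_nonneg_nonneg mult_nonneg_nonneg)
    then have "card B * a \<le> card B * (ln 4 * e + P * x * \<delta>)"
      by (simp add: algebra_simps)
    then have "a \<le> ln 4 * e + P * x * \<delta>"
      using cB by simp
    then have "(P * (x / 2 - x\<^sup>2 / 2 - x * \<delta>) - ln 2) / ln 4 \<le> e"
      by (simp add: a_def pos_divide_le_eq algebra_simps)
    then show ?thesis using real by (simp add: ennreal_leI)
  qed simp
qed

subsection \<open>Support\<close>

lemma support_eq_length_filter: "support S X = length (filter (\<lambda>T. X \<subseteq> T) S)"
  by (simp add: support_def length_filter_conv_card)

lemma support_append: "support (S @ S') X = support S X + support S' X"
  by (simp add: support_eq_length_filter)

lemma support_concat_replicate: "support (concat (replicate s S)) X = s * support S X"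
  by (induction s) (simp_all add: support_append, simp add: support_eq_length_filter)

lemma support_replicate: "support (replicate r T) X = (if X \<subseteq> T then r else 0)"
  by (simp add: support_eq_length_filter)

lemma support_take_le: "support (take M S) X \<le> support S X"
  using support_append[of "take M S" "drop M S" X] by simp

text \<open>A subset of a finite set with the same cardinality is the whole set;
  \<open>0 < k\<close> supplies finiteness.\<close>

lemma support_eq_count_list:
  assumes "\<forall>T\<in>set S. card T = k" "card X = k" "0 < k"
  shows "support S X = count_list S X"
  using assms(1)
proof (induction S)
  case (Cons T S)
  have "X \<subseteq> T \<longleftrightarrow> X = T"
    using Cons.prems assms(2,3) card_subset_eq[of T X] card_ge_0_finite[of T] by auto
  then show ?case using Cons by (simp add: support_eq_length_filter)
qed (simp add: support_eq_length_filter)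

lemma count_list_distinct: "distinct S \<Longrightarrow> count_list S X = (if X \<in> set S then 1 else 0)"
  by (induction S) (auto simp: count_list_0_iff)

lemma support_concat_map:
  "support (concat (map f [0..<P])) X = (\<Sum>i<P. support (f i) X)"
  by (induction P) (simp_all add: support_append, simp add: support_eq_length_filter)

subsection \<open>Families of itemsets\<close>

text \<open>The items are coloured by \<open>{..<k}\<close>: the number \<open>1 + j + k * v\<close> is item \<open>v\<close> of colour \<open>j\<close>.\<close>

definition transversal :: "nat \<Rightarrow> (nat \<Rightarrow> nat) \<Rightarrow> nat set" where
  "transversal k f = (\<lambda>j. 1 + j + k * f j) ` {..<k}"

lemma item_inject:
  assumes "j < k" "j' < k"
  shows "1 + j + k * v = 1 + j' + k * v' \<longleftrightarrow> j = j' \<and> v = (v'::nat)"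
proof
  assume "1 + j + k * v = 1 + j' + k * v'"
  then have eq: "k * v + j = k * v' + j'" by simp
  have "(k * v + j) mod k = j" "(k * v' + j') mod k = j'" "(k * v + j) div k = v" "(k * v' + j') div k = v'"
    using assms by auto
  then show "j = j' \<and> v = v'" using eq by metis
qed auto

lemma card_transversal: "card (transversal k f) = k"
  unfolding transversal_def by (subst card_image) (auto simp: inj_on_def item_inject simp del: One_nat_def)

lemma mem_transversal: "j < k \<Longrightarrow> 1 + j + k * v \<in> transversal k f \<longleftrightarrow> f j = v"
  unfolding transversal_def by (auto simp: image_iff item_inject simp del: One_nat_def plus_1_eq_Suc add_Suc)

lemma inj_on_transversal: "inj_on (transversal k) ({..<k} \<rightarrow>\<^sub>E V)"
proof (rule inj_onI)
  fix f g assume fg: "f \<in> {..<k} \<rightarrow>\<^sub>E V" "g \<in> {..<k} \<rightarrow>\<^sub>E V" and eq: "transversal k f = transversal k g"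
  show "f = g"
  proof (rule PiE_ext[OF fg])
    fix j assume "j \<in> {..<k}"
    then show "f j = g j" using mem_transversal[of j k "g j" f] mem_transversal[of j k "g j" g] eq by simp
  qed
qed

lemma transversal_subset:
  assumes "f \<in> {..<k} \<rightarrow>\<^sub>E {..<h}" "k * h \<le> n"
  shows "transversal k f \<subseteq> {1..n}"
proof -
  have "1 + j + k * f j \<le> n" if "j < k" for j
  proof -
    have "Suc (f j) \<le> h" using PiE_mem[OF assms(1), of j] that by simp
    then have "k * Suc (f j) \<le> k * h" by (rule mult_le_mono2)
    with that assms(2) show ?thesis by simp
  qed
  then show ?thesis by (auto simp: transversal_def)
qed

text \<open>\<open>xs\<close> and \<open>ys\<close> will form the pairs, \<open>gs\<close> the
  filling sets. The values are split into three blocks of length \<open>h\<close>: \<open>xs\<close>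
  uses the first, \<open>ys\<close> the second, and a member of \<open>gs\<close> has some value in
  the third, which keeps the families disjoint although \<open>gs\<close> may share items with
  \<open>xs\<close>.\<close>

lemma transversal_families:
  assumes k: "0 < k" and h: "0 < h" and n: "k * (3 * h) \<le> n"
  obtains xs ys gs where
    "length xs = h ^ k" "length ys = h ^ k" "distinct (xs @ ys @ gs)"
    "h ^ k \<le> length gs" "length gs \<le> (3 * h) ^ k"
    "\<And>T. T \<in> set (xs @ ys @ gs) \<Longrightarrow> T \<subseteq> {1..n} \<and> card T = k"
    "\<And>T i. T \<in> set xs \<Longrightarrow> i \<in> T \<Longrightarrow> 2 \<le> k \<Longrightarrow> h ^ (k - 1) \<le> support gs {i}"
proof -
  define A0 where "A0 = {..<k} \<rightarrow>\<^sub>E {..<h}"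
  define A1 where "A1 = {..<k} \<rightarrow>\<^sub>E {h..<2*h}"
  define A2 where "A2 = {..<k} \<rightarrow>\<^sub>E {2*h..<3*h}"
  define A where "A = {..<k} \<rightarrow>\<^sub>E {..<3*h}"
  define G where "G = {f \<in> A. \<exists>j<k. 2 * h \<le> f j}"
  have sub: "A0 \<subseteq> A" "A1 \<subseteq> A" "A2 \<subseteq> A" "G \<subseteq> A"
    unfolding A0_def A1_def A2_def A_def G_def by (auto intro!: PiE_mono)
  have finA: "finite A" by (simp add: A_def finite_PiE)
  have fin: "finite A0" "finite A1" "finite A2" "finite G"
    using sub finA by (auto intro: finite_subset)
  have A2G: "A2 \<subseteq> G"
  proof
    fix f assume f: "f \<in> A2"
    then have "2 * h \<le> f 0" using PiE_mem[of f "{..<k}" "\<lambda>_. {2*h..<3*h}" 0] k by (simp add: A2_def)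
    then show "f \<in> G" using f sub(3) k by (auto simp: G_def)
  qed
  have card: "card A0 = h ^ k" "card A1 = h ^ k" "card A2 = h ^ k" "card A = (3 * h) ^ k"
    by (simp_all add: A0_def A1_def A2_def A_def card_PiE)
  have disj: "A0 \<inter> A1 = {}" "A0 \<inter> G = {}" "A1 \<inter> G = {}"
  proof -
    have A0: "f j < h" if "f \<in> A0" "j < k" for f j
      using PiE_mem[of f "{..<k}" "\<lambda>_. {..<h}" j] that by (simp add: A0_def)
    have A1: "h \<le> f j \<and> f j < 2 * h" if "f \<in> A1" "j < k" for f j
      using PiE_mem[of f "{..<k}" "\<lambda>_. {h..<2*h}" j] that by (simp add: A1_def)
    show "A0 \<inter> A1 = {}" using A0[OF _ k] A1[OF _ k] by fastforce
    show "A0 \<inter> G = {}" using A0 by (fastforce simp: G_def)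
    show "A1 \<inter> G = {}" using A1 by (fastforce simp: G_def)
  qed
  have inj: "inj_on (transversal k) A"
    by (simp add: A_def inj_on_transversal)
  have cardim: "card (transversal k ` F) = card F" if "F \<subseteq> A" for F
    using that inj by (meson card_image inj_on_subset)
  have disjim: "transversal k ` F \<inter> transversal k ` F' = {}" if "F \<subseteq> A" "F' \<subseteq> A" "F \<inter> F' = {}" for F F'
    using inj_on_image_Int[OF inj that(1,2)] that(3) by simp
  obtain xs where xs: "set xs = transversal k ` A0" "distinct xs"
    using finite_distinct_list fin by (metis finite_imageI)
  obtain ys where ys: "set ys = transversal k ` A1" "distinct ys"
    using finite_distinct_list fin by (metis finite_imageI)
  obtain gs where gs: "set gs = transversal k ` G" "distinct gs"
    using finite_distinct_list fin by (metis finite_imageI)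
  have lgs: "length gs = card G"
    using gs sub cardim by (metis distinct_card)
  show ?thesis
  proof
    show "length xs = h ^ k" "length ys = h ^ k"
      using xs ys sub cardim card by (metis distinct_card)+
    show "distinct (xs @ ys @ gs)"
      using xs ys gs disjim sub disj by (auto simp: Int_Un_distrib)
    show "h ^ k \<le> length gs"
      using card_mono[OF fin(4) A2G] lgs card by simp
    show "length gs \<le> (3 * h) ^ k"
      using card_mono[OF finA sub(4)] lgs card by simp
    show "T \<subseteq> {1..n} \<and> card T = k" if "T \<in> set (xs @ ys @ gs)" for T
    proof -
      obtain f where "f \<in> A" "T = transversal k f"
        using \<open>T \<in> set (xs @ ys @ gs)\<close> xs ys gs sub by auto
      then show ?thesis using transversal_subset[of f k "3 * h" n] n by (simp add: card_transversal A_def)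
    qed
    show "h ^ (k - 1) \<le> support gs {i}" if T: "T \<in> set xs" "i \<in> T" and k2: "2 \<le> k" for T i
    proof -
      obtain f j where f: "f \<in> A0" "j < k" "i = 1 + j + k * f j"
        using T xs by (auto simp: transversal_def)
      have fj: "f j < h" using f by (auto simp: A0_def PiE_iff)
      \<comment> \<open>The item \<open>i\<close> of colour \<open>j\<close> is kept while the other
        \<open>k - 1\<close> colours range over the third block. For \<open>2 \<le> k\<close> there
        is another colour, so the resulting set belongs to \<open>gs\<close>.\<close>
      define H where "H = ({..<k} - {j}) \<rightarrow>\<^sub>E {2*h..<3*h}"
      have cH: "card H = h ^ (k - 1)" using f by (simp add: H_def card_PiE)
      have up: "g(j := f j) \<in> G" if "g \<in> H" for g
      proof -
        have "g(j := f j) \<in> A"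
          using \<open>g \<in> H\<close> fj f(2) by (auto simp: A_def H_def PiE_iff extensional_def)
        moreover obtain j' where "j' < k" "j' \<noteq> j"
          using k2 that[of "if j = 0 then 1 else 0"] by auto
        then have "\<exists>j'<k. 2 * h \<le> (g(j := f j)) j'"
          using \<open>g \<in> H\<close> by (intro exI[of _ j']) (auto simp: H_def PiE_iff)
        ultimately show ?thesis by (simp add: G_def)
      qed
      have injup: "inj_on (\<lambda>g. g(j := f j)) H"
      proof (rule inj_onI)
        fix g g' assume gg: "g \<in> H" "g' \<in> H" and eq: "g(j := f j) = g'(j := f j)"
        show "g = g'"
        proof (rule PiE_ext[OF gg[unfolded H_def]])
          fix i' assume "i' \<in> {..<k} - {j}"
          then show "g i' = g' i'" using fun_cong[OF eq, of i'] by simp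
        qed
      qed
      have "h ^ (k - 1) = card (transversal k ` (\<lambda>g. g(j := f j)) ` H)"
      proof -
        have "(\<lambda>g. g(j := f j)) ` H \<subseteq> A" using up sub(4) by blast
        then show ?thesis using cH card_image[OF injup] cardim by simp
      qed
      also have "\<dots> \<le> card {T \<in> set gs. {i} \<subseteq> T}"
        using up f fin gs mem_transversal[of j k "f j"] by (intro card_mono) auto
      also have "\<dots> = support gs {i}"
        using gs by (metis support_eq_length_filter distinct_card distinct_filter set_filter)
      finally show ?thesis .
    qed
  qed
qed

subsection \<open>The hard distribution\<close>

text \<open>\<open>D\<close> is chosen before \<open>\<alpha>\<close>, \<open>R\<close>,
  \<open>\<delta>\<close> and \<open>x\<close>: the streams depend only on the parameters, so one
  distribution is hard for all algorithms.\<close>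

lemma hard_distribution:
  fixes k h m n \<phi> :: nat
  assumes k: "0 < k" and h: "4 \<le> h" and n: "k * (3 * h) \<le> n"
    and m16: "16 * h ^ k \<le> m" and m4: "4 * (3 * h) ^ k \<le> m" and m8: "8 * 3 ^ k * h * \<phi> \<le> m"
  shows "\<exists>D. set_pmf D \<subseteq> inputs k m n \<and> (\<forall>\<alpha> R \<delta> x. \<alpha> < 2 \<longrightarrow> 0 \<le> x \<longrightarrow> estimates R k m n \<phi> \<alpha> \<delta> \<longrightarrow>
    ennreal ((real (h ^ k) * (x / 2 - x\<^sup>2 / 2 - x * \<delta>) - ln 2) / ln 4) \<le> expected_space R D)"
proof -
  have h0: "0 < h" using h by simp
  obtain xs ys gs where lx: "length xs = h ^ k" and ly: "length ys = h ^ k"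
    and dist: "distinct (xs @ ys @ gs)" and F: "h ^ k \<le> length gs" "length gs \<le> (3 * h) ^ k"
    and sets: "\<And>T. T \<in> set (xs @ ys @ gs) \<Longrightarrow> T \<subseteq> {1..n} \<and> card T = k"
    and cover: "\<And>T i. T \<in> set xs \<Longrightarrow> i \<in> T \<Longrightarrow> 2 \<le> k \<Longrightarrow> h ^ (k - 1) \<le> support gs {i}"
    by (rule transversal_families[OF k h0 n]) (rule that)
  define P where "P = h ^ k"
  \<comment> \<open>This rounding gives \<open>m < 2 * (P * r)\<close>, so the space left for
    filling is at most \<open>r * P \<le> r * length gs\<close> and no filling set occurs more than
    \<open>r\<close> times.\<close>
  define r where "r = m div (2 * P) + 1"
  \<comment> \<open>\<open>s\<close> rounds of \<open>gs\<close> take up at most a quarter of the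
    stream; \<open>rP\<close> shows that at least a quarter is left for \<open>fill\<close>.\<close>
  define s where "s = m div (4 * length gs)"
  define M where "M = m - r * (P + 1)"
  define w where "w b i = (if b i then xs ! i else ys ! i)" for b i
  define pre where "pre b = concat (map (\<lambda>i. replicate r (w b i)) [0..<P])" for b
  define fill where "fill = take M (concat (replicate r gs))"
  define suf where "suf j = replicate r (xs ! j) @ fill" for j
  define B where "B = {..<P} \<rightarrow>\<^sub>E (UNIV :: bool set)"

  have P4: "4 \<le> P" using h self_le_power[of h k] k by (simp add: P_def)
  then have P: "0 < P" by simp
  have Pl: "P \<le> length gs" using F by (simp add: P_def)
  have m2: "m < 2 * (P * r)"
  proof -
    have "m = 2 * P * (m div (2 * P)) + m mod (2 * P)" by simp
    moreover have "m mod (2 * P) < 2 * P" using P by simp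
    ultimately show ?thesis unfolding r_def by (simp add: algebra_simps)
  qed
  have rP: "4 * (r * (P + 1)) \<le> 3 * m"
  proof -
    define a where "a = m div (2 * P)"
    have "2 * (P * a) \<le> m"
      unfolding a_def by (metis mult.assoc times_div_less_eq_dividend)
    moreover have "4 * a \<le> P * a" using P4 by simp
    moreover have "16 * P \<le> m" using m16 by (simp add: P_def)
    moreover have "4 * (r * (P + 1)) = 4 * (P * a) + 4 * a + 4 * P + 4"
      by (simp add: r_def a_def algebra_simps)
    ultimately show ?thesis using P4 by linarith
  qed
  have mM: "r * P + (r + M) = m" using rP by (simp add: M_def algebra_simps)
  have MrF: "M \<le> r * length gs"
    using mM m2 mult_le_mono2[OF Pl, of r] by (simp only: mult.commute[of P r])
  have sM: "s * length gs \<le> M"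
  proof -
    have "4 * (s * length gs) \<le> m"
      unfolding s_def by (metis div_times_less_eq_dividend mult.assoc mult.commute)
    then show ?thesis using rP by (simp add: M_def)
  qed
  have gs0: "0 < length gs" using P Pl by linarith
  have sr: "s \<le> r"
  proof -
    have "s * length gs \<le> r * length gs" using sM MrF by (rule order_trans)
    then show ?thesis using gs0 by simp
  qed
  \<comment> \<open>Since \<open>1 \<le> s\<close>, rounding down loses at most a factor 2. Together
    with the \<open>4\<close> in \<open>s\<close> and \<open>length gs \<le> (3 * h) ^ k\<close>
    this accounts for the constant in \<open>m8\<close>.\<close>
  have s\<phi>: "\<phi> \<le> s * h ^ (k - 1)"
  proof -
    have "4 * length gs \<le> m" using F(2) m4 by simp
    then have s1: "1 \<le> s" unfolding s_def using gs0 by (simp add: div_greater_zero_iff Suc_le_eq)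
    have "m = 4 * length gs * s + m mod (4 * length gs)" by (simp add: s_def)
    moreover have "m mod (4 * length gs) < 4 * length gs" using gs0 by simp
    moreover have "4 * length gs \<le> 4 * length gs * s" using s1 by simp
    ultimately have "m \<le> 8 * (length gs * s)" by linarith
    also have "\<dots> \<le> 8 * ((3 * h) ^ k * s)" using F(2) by simp
    also have "\<dots> = 8 * 3 ^ k * h * (h ^ (k - 1) * s)"
      using k by (cases k) (simp_all add: power_mult_distrib)
    finally have "8 * 3 ^ k * h * \<phi> \<le> 8 * 3 ^ k * h * (h ^ (k - 1) * s)"
      using m8 by (rule order_trans[rotated])
    then show ?thesis using h by (simp add: mult.commute)
  qed

  have lenp: "length (pre b) = r * P" for b
    by (simp add: pre_def length_concat comp_def sum_list_triv)
  have lens: "length (suf j) = r + M" for j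
    using MrF by (simp add: suf_def fill_def length_concat sum_list_replicate)
  have xsP: "xs ! j \<in> set xs" "ys ! j \<in> set ys" if "j < P" for j
    using that lx ly by (simp_all add: P_def)
  have fillgs: "set fill \<subseteq> set gs"
    unfolding fill_def using set_take_subset by fastforce
  have tr: "T \<subseteq> {1..n} \<and> card T = k" if "T \<in> set (pre b @ suf j)" "j < P" for T b j
    using that xsP fillgs by (intro sets) (auto simp: pre_def suf_def w_def split: if_splits)
  have inp: "pre b @ suf j \<in> inputs k m n" if j: "j < P" for b j
  proof -
    have "sum_list (map card S) = length S * k" if "\<forall>T\<in>set S. card T = k" for S :: "nat set list"
      using that by (induction S) auto
    then have "sum_list (map card (pre b @ suf j)) = length (pre b @ suf j) * k"
      using tr j by blast
    then show ?thesis using tr[OF _ j] lenp lens mM by (auto simp: inputs_def)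
  qed
  have fincand: "finite (candidates k n \<phi> S)" for S
    by (rule finite_subset[of _ "Pow {1..n}"]) (auto simp: candidates_def)
  \<comment> \<open>For \<open>k = 1\<close> no filling set contains the queried item, but there \<open>\<phi> \<le> r\<close>.\<close>
  have cand: "xs ! j \<in> candidates k n \<phi> (pre b @ suf j)" if j: "j < P" for b j
  proof -
    have "\<phi> \<le> support (pre b @ suf j) {i}" if i: "i \<in> xs ! j" for i
    proof (cases "k = 1")
      case True
      then have "24 * h * \<phi> \<le> m" "m < 2 * (h * r)" using m8 m2 by (simp_all add: P_def)
      then have "h * (12 * \<phi>) < h * r" by linarith
      then have "\<phi> \<le> r" by simp
      then show ?thesis using i by (simp add: suf_def support_append support_replicate)
    next
      case False
      then have "s * h ^ (k - 1) \<le> s * support gs {i}"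
        using cover[OF _ i] xsP(1)[OF j] k by simp
      also have "\<dots> = support (concat (replicate s gs)) {i}"
        by (simp add: support_concat_replicate)
      \<comment> \<open>The filling runs through \<open>gs\<close> round by round, so its truncation
        to \<open>M\<close> still begins with \<open>s\<close> complete rounds.\<close>
      also have "\<dots> = support (take (s * length gs) (concat (replicate r gs))) {i}"
      proof -
        have "replicate r gs = replicate s gs @ replicate (r - s) gs"
          using sr by (simp flip: replicate_add)
        then show ?thesis by (simp add: length_concat sum_list_replicate)
      qed
      also have "\<dots> = support (take (s * length gs) fill) {i}"
        using sM by (simp add: fill_def min_def)
      also have "\<dots> \<le> support fill {i}" by (rule support_take_le)
      finally show ?thesis using s\<phi> by (simp add: suf_def support_append)
    qed
    then show ?thesis using sets[of "xs ! j"] xsP(1)[OF j] by (auto simp: candidates_def)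
  qed
  have yes: "2 * r \<le> s_max k n \<phi> (pre b @ suf j)" if j: "j < P" "b j" for b j
  proof -
    have "r = support (replicate r (w b j)) (xs ! j)" using j by (simp add: w_def support_replicate)
    also have "\<dots> \<le> (\<Sum>i<P. support (replicate r (w b i)) (xs ! j))"
      using j by (intro member_le_sum) auto
    also have "\<dots> = support (pre b) (xs ! j)" by (simp add: pre_def support_concat_map)
    finally have "2 * r \<le> support (pre b @ suf j) (xs ! j)"
      by (simp add: suf_def support_append support_replicate)
    also have "\<dots> \<le> s_max k n \<phi> (pre b @ suf j)"
      unfolding s_max_def using cand[OF j(1)] fincand by (intro Max_ge) auto
    finally show ?thesis .
  qed
  have no: "s_max k n \<phi> (pre b @ suf j) \<le> r" if j: "j < P" "\<not> b j" for b j
  proof -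
    \<comment> \<open>All transactions have \<open>k\<close> items, so \<open>Z\<close> is supported
      only by copies of itself. As bit \<open>j\<close> is not set, the prefix, the copies of
      \<open>xs ! j\<close> and the filling have no set in common, and each contains a set at most
      \<open>r\<close> times.\<close>
    have "support (pre b @ suf j) Z \<le> r" if Z: "card Z = k" for Z
    proof -
      have eq: "Z \<subseteq> T \<longleftrightarrow> Z = T" if "T \<in> set (xs @ ys @ gs)" for T
        using sets[OF that] Z k card_subset_eq[of T Z] card_ge_0_finite[of T] by auto
      have w_mem: "w b i \<in> set xs \<union> set ys" if "i < P" for i
        using xsP[OF that] by (simp add: w_def)
      have ne: "xs ! i \<noteq> ys ! i'" "ys ! i' \<noteq> xs ! i" if "i < P" "i' < P" for i i'
        using xsP(1)[OF that(1)] xsP(2)[OF that(2)] dist by auto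
      have w_inj: "w b i = w b i' \<longleftrightarrow> i = i'" if "i < P" "i' < P" for i i'
        using that dist lx ly ne by (auto simp: w_def P_def nth_eq_iff_index_eq)
      have w_ne: "w b i \<noteq> xs ! j" if "i < P" for i
        using that j dist lx ne by (auto simp: w_def P_def nth_eq_iff_index_eq)
      have pre: "support (pre b) Z = (\<Sum>i<P. if Z = w b i then r else 0)"
        unfolding pre_def support_concat_map
        using w_mem eq by (intro sum.cong) (auto simp: support_replicate)
      have suf: "support (suf j) Z = (if Z = xs ! j then r else 0) + support fill Z"
        using eq[of "xs ! j"] xsP(1)[OF j(1)] by (simp add: suf_def support_append support_replicate)
      have "support fill Z \<le> r * support gs Z"
        unfolding fill_def using support_take_le support_concat_replicate by metis
      also have "support gs Z = count_list gs Z"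
        by (rule support_eq_count_list[OF _ Z k]) (use sets in auto)
      also have "\<dots> = (if Z \<in> set gs then 1 else 0)"
        using dist by (simp add: count_list_distinct)
      finally have fill: "support fill Z \<le> (if Z \<in> set gs then r else 0)" by (simp split: if_splits)
      show ?thesis
      proof (cases "\<exists>i<P. Z = w b i")
        case True
        then obtain i where i: "i < P" "Z = w b i" by auto
        have "support (pre b) Z = (\<Sum>i'<P. if i' = i then r else 0)"
          unfolding pre using i w_inj by (intro sum.cong) auto
        then have "support (pre b) Z = r" using i by simp
        moreover have "Z \<notin> set gs" using w_mem[OF i(1)] i dist by auto
        ultimately show ?thesis using suf fill w_ne[OF i(1)] i by (simp add: support_append)
      next
        case False
        then have "support (pre b) Z = 0" unfolding pre by (intro sum.neutral) auto
        moreover have "\<not> (Z = xs ! j \<and> Z \<in> set gs)" using xsP(1)[OF j(1)] dist by auto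
        ultimately show ?thesis using suf fill by (auto simp: support_append split: if_splits)
      qed
    qed
    then show ?thesis
      unfolding s_max_def using cand[OF j(1)] fincand
      by (subst Max_le_iff) (auto simp: candidates_def)
  qed
  show ?thesis
  proof (intro exI[of _ "map_pmf (\<lambda>b. pre b @ suf 0) (pmf_of_set B)"] conjI allI impI)
    have "finite B" "B \<noteq> {}"
      by (auto simp: B_def finite_PiE PiE_eq_empty_iff)
    then show "set_pmf (map_pmf (\<lambda>b. pre b @ suf 0) (pmf_of_set B)) \<subseteq> inputs k m n"
      using inp[OF P] by auto
  next
    fix \<alpha> x \<delta> :: real and R
    assume \<alpha>: "\<alpha> < 2" and x: "0 \<le> x" and est: "estimates R k m n \<phi> \<alpha> \<delta>"
    show "ennreal ((real (h ^ k) * (x / 2 - x\<^sup>2 / 2 - x * \<delta>) - ln 2) / ln 4)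
        \<le> expected_space R (map_pmf (\<lambda>b. pre b @ suf 0) (pmf_of_set B))"
      unfolding B_def P_def[symmetric]
    proof (rule expected_space_ge[where r = r and t = "r * P", OF x \<alpha> est])
      show "candidates k n \<phi> (pre b @ suf j) \<noteq> {}" if "j < P" for b j
        using cand[OF that] by blast
      show "0 < r" by (simp add: r_def)
    qed (use lenp inp yes no P in simp_all)
  qed
qed

section \<open>Choice of the constants and the asymptotic bound\<close>

text \<open>Taking \<open>h\<close> as the integer part of a small multiple of the
  \<open>k\<close>-th root of \<open>L\<close> satisfies all size conditions of
  \<open>hard_distribution\<close> and keeps \<open>h ^ k\<close> a constant fraction of
  \<open>L\<close>. The constants \<open>c\<close> and \<open>N\<close> depend on \<open>k\<close>
  and \<open>\<delta>\<close> only.\<close>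

theorem theorem1:
  fixes k :: nat and \<delta> :: real
  assumes "0 < k" and "\<delta> < 1 / 2"
  shows "\<exists>c::real. c > 0 \<and> (\<exists>N::real. \<forall>m n \<phi> :: nat.
           let L = min (real m) (min (real n ^ k) ((real m / real \<phi>) ^ k))
           in 0 < \<phi> \<longrightarrow> N \<le> L \<longrightarrow>
             (\<exists>D :: nat set list pmf. set_pmf D \<subseteq> inputs k m n \<and>
                (\<forall>\<alpha>::real. \<alpha> < 2 \<longrightarrow>
                  (\<forall>R :: algorithm pmf. estimates R k m n \<phi> \<alpha> \<delta> \<longrightarrow>
                     ennreal (c * L) \<le> expected_space R D))))"
proof -
  \<comment> \<open>This \<open>x\<close> maximises \<open>x / 2 - x\<^sup>2 / 2 - x * \<delta>\<close>, with value \<open>x\<^sup>2 / 2\<close>.\<close>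
  define x where "x = 1 / 2 - \<delta>"
  \<comment> \<open>One constant for all size conditions: it gives
    \<open>h * (16 * 3 ^ k * k) \<le> root k L\<close>, and
    \<open>16 * 3 ^ k * h ^ k \<le> m\<close> because
    \<open>\<beta> ^ k \<le> \<beta>\<close>.\<close>
  define \<beta> :: real where "\<beta> = 1 / (16 * 3 ^ k * k)"
  \<comment> \<open>A lower bound for \<open>h\<close>: the second entry makes \<open>ln 2\<close>
    at most half of the main term \<open>h ^ k * x\<^sup>2 / 2\<close>.\<close>
  define H where "H = max 4 (4 * ln 2 / x\<^sup>2)"
  \<comment> \<open>\<open>x\<^sup>2 / 4\<close> is what remains of \<open>x\<^sup>2 / 2\<close>
    after \<open>ln 2\<close> is subtracted; \<open>(\<beta> / 2) ^ k\<close> comes from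
    \<open>h_ge\<close>.\<close>
  define c where "c = x\<^sup>2 / (4 * ln 4) * (\<beta> / 2) ^ k"
  \<comment> \<open>For \<open>N \<le> L\<close> the number rounded down to \<open>h\<close> is at
    least \<open>2 * H\<close>, so rounding at most halves it and \<open>H \<le> h\<close>.\<close>
  define N where "N = (2 * H / \<beta>) ^ k"
  have x: "0 < x" using assms by (simp add: x_def)
  have \<beta>: "0 < \<beta>" using assms by (simp add: \<beta>_def)
  have H: "4 \<le> H" "4 * ln 2 \<le> H * x\<^sup>2" using x by (simp_all add: H_def flip: pos_divide_le_eq)
  have k3: "1 \<le> real k * 3 ^ k"
    using mult_mono[of 1 "real k" 1 "3 ^ k"] assms by simp
  have c: "0 < c" using x \<beta> by (simp add: c_def)
  have main: "\<exists>D :: nat set list pmf. set_pmf D \<subseteq> inputs k m n \<and>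
      (\<forall>\<alpha>::real. \<alpha> < 2 \<longrightarrow> (\<forall>R :: algorithm pmf. estimates R k m n \<phi> \<alpha> \<delta> \<longrightarrow>
        ennreal (c * L) \<le> expected_space R D))"
    if L: "L = min (real m) (min (real n ^ k) ((real m / real \<phi>) ^ k))" and \<phi>: "0 < \<phi>" and NL: "N \<le> L"
    for m n \<phi> :: nat and L
  proof -
    define \<rho> where "\<rho> = root k L"
    define h where "h = nat \<lfloor>\<beta> * \<rho>\<rfloor>"
    have N0: "0 < N" using H \<beta> by (simp add: N_def)
    then have L0: "0 < L" using NL by simp
    have \<rho>0: "0 \<le> \<rho>" using L0 assms by (simp add: \<rho>_def)
    have \<rho>k: "\<rho> ^ k = L" using L0 assms by (simp add: \<rho>_def)
    have le: "\<rho> \<le> z" if "L \<le> z ^ k" "0 \<le> z" for z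
      using that assms \<rho>k by (meson power_less_imp_less_base not_le power_strict_mono)
    have \<rho>n: "\<rho> \<le> n" by (rule le) (auto simp: L)
    have \<rho>m: "\<rho> \<le> real m / real \<phi>" by (rule le) (auto simp: L)
    have \<rho>H: "2 * H \<le> \<beta> * \<rho>"
    proof -
      have "(2 * H / \<beta>) ^ k \<le> \<rho> ^ k" using NL by (simp add: N_def \<rho>k)
      then have "2 * H / \<beta> \<le> \<rho>" using \<rho>0 H(1) \<beta> assms by (subst (asm) power_mono_iff) auto
      then show ?thesis using \<beta> by (simp add: pos_divide_le_eq mult.commute)
    qed
    have h_le: "real h \<le> \<beta> * \<rho>" using \<beta> \<rho>0 by (simp add: h_def)
    have h_ge: "\<beta> * \<rho> / 2 \<le> real h"
    proof -
      have "\<beta> * \<rho> < real h + 1" using \<beta> \<rho>0 by (simp add: h_def)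
      then show ?thesis using \<rho>H H by linarith
    qed
    have hH: "H \<le> h" using \<rho>H h_ge by linarith
    have h4: "4 \<le> h" using hH H by linarith
    have \<beta>1: "\<beta> * (16 * 3 ^ k * k) = 1" using assms by (simp add: \<beta>_def)
    have hk: "real (h ^ k) \<le> \<beta> ^ k * m"
    proof -
      have "real h ^ k \<le> (\<beta> * \<rho>) ^ k" using h_le by (intro power_mono) auto
      also have "\<dots> \<le> \<beta> ^ k * m" using \<beta> by (simp add: power_mult_distrib \<rho>k L)
      finally show ?thesis by simp
    qed
    have \<beta>k: "16 * 3 ^ k * \<beta> ^ k \<le> 1"
    proof -
      have b1: "\<beta> \<le> 1" using k3 by (simp add: \<beta>_def mult.commute)
      have "\<beta> ^ k \<le> \<beta>" using power_decreasing[of 1 k \<beta>] b1 \<beta> assms by simp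
      then have "16 * 3 ^ k * \<beta> ^ k \<le> 16 * 3 ^ k * \<beta> * 1"
        using mult_left_mono[of "\<beta> ^ k" \<beta> "16 * 3 ^ k"] by simp
      also have "\<dots> \<le> 16 * 3 ^ k * \<beta> * real k"
        using assms \<beta> by (intro mult_left_mono) auto
      also have "\<dots> = 1" using \<beta>1 by (simp add: mult_ac)
      finally show ?thesis .
    qed
    have bound: "16 * 3 ^ k * h ^ k \<le> m"
    proof -
      have "real (16 * 3 ^ k * h ^ k) \<le> 16 * 3 ^ k * (\<beta> ^ k * m)"
        using mult_left_mono[OF hk, of "16 * 3 ^ k"] by simp
      also have "\<dots> \<le> 1 * real m"
        using mult_right_mono[OF \<beta>k, of "real m"] by (simp add: mult.assoc)
      finally show ?thesis by (simp only: mult_1 of_nat_le_iff)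
    qed
    have 1: "k * (3 * h) \<le> n"
    proof -
      have "real h * (16 * 3 ^ k * k) \<le> \<beta> * \<rho> * (16 * 3 ^ k * k)"
        using h_le by (intro mult_right_mono) auto
      also have "\<dots> = \<rho>" using \<beta>1 by (metis mult.commute mult.left_commute mult_1)
      finally have "real (h * (16 * 3 ^ k * k)) \<le> n" using \<rho>n by simp
      then have "h * (16 * 3 ^ k * k) \<le> n" by (simp only: of_nat_le_iff)
      moreover have "3 * (h * k) \<le> 16 * 3 ^ k * (h * k)"
        using mult_le_mono[of 3 16 1 "3 ^ k"] by (intro mult_le_mono1) simp
      moreover have "16 * 3 ^ k * (h * k) = h * (16 * 3 ^ k * k)" "k * (3 * h) = 3 * (h * k)"
        by simp_all
      ultimately show ?thesis by linarith
    qed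
    have 2: "16 * h ^ k \<le> m"
    proof -
      have "16 * h ^ k * 1 \<le> 16 * h ^ k * 3 ^ k" by (rule mult_le_mono2) simp
      also have "\<dots> = 16 * 3 ^ k * h ^ k" by simp
      finally show ?thesis using bound by linarith
    qed
    have 3: "4 * (3 * h) ^ k \<le> m" using bound by (simp add: power_mult_distrib)
    have 4: "8 * 3 ^ k * h * \<phi> \<le> m"
    proof -
      have "real h * (16 * 3 ^ k * k) \<le> \<beta> * \<rho> * (16 * 3 ^ k * k)"
        using h_le by (intro mult_right_mono) auto
      also have "\<dots> = \<rho>" using \<beta>1 by (metis mult.commute mult.left_commute mult_1)
      also have "\<dots> \<le> real m / real \<phi>" by (rule \<rho>m)
      finally have "real h * (16 * 3 ^ k * k) * \<phi> \<le> m" using \<phi> by (simp add: pos_le_divide_eq)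
      then have "real (h * (16 * 3 ^ k * k) * \<phi>) \<le> real m" by simp
      then have "h * (16 * 3 ^ k * k) * \<phi> \<le> m" by (simp only: of_nat_le_iff)
      moreover have "8 * 3 ^ k * h * \<phi> * 1 \<le> 8 * 3 ^ k * h * \<phi> * (2 * k)"
        using assms by (intro mult_le_mono2) auto
      moreover have "8 * 3 ^ k * h * \<phi> * (2 * k) = h * (16 * 3 ^ k * k) * \<phi>"
        by simp
      ultimately show ?thesis by linarith
    qed
    have final: "c * L \<le> (real (h ^ k) * (x / 2 - x\<^sup>2 / 2 - x * \<delta>) - ln 2) / ln 4"
    proof -
      define q where "q = real (h ^ k)"
      have "h \<le> h ^ k" using h4 assms by (intro self_le_power) auto
      then have "real h \<le> q" unfolding q_def by (rule of_nat_mono)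
      then have "H * x\<^sup>2 \<le> q * x\<^sup>2" using hH by (intro mult_right_mono) auto
      then have ln2: "4 * ln 2 \<le> q * x\<^sup>2" using H(2) by (rule order_trans[rotated])
      have \<delta>: "\<delta> = 1 / 2 - x" by (simp add: x_def)
      have "x / 2 - x\<^sup>2 / 2 - x * \<delta> = x\<^sup>2 / 2"
        unfolding \<delta> by (simp add: power2_eq_square algebra_simps)
      then have "q * (x / 2 - x\<^sup>2 / 2 - x * \<delta>) = q * x\<^sup>2 / 2" by simp
      then have le_num: "q * x\<^sup>2 / 4 \<le> q * (x / 2 - x\<^sup>2 / 2 - x * \<delta>) - ln 2"
        using ln2 by linarith
      have "(\<beta> * \<rho> / 2) ^ k \<le> real h ^ k" using h_ge \<beta> \<rho>0 by (intro power_mono) auto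
      then have "(\<beta> / 2) ^ k * L \<le> q"
        by (simp add: power_mult_distrib power_divide \<rho>k q_def)
      then have "(\<beta> / 2) ^ k * L * (x\<^sup>2 / 4) \<le> q * (x\<^sup>2 / 4)"
        by (rule mult_right_mono) simp
      then have "(\<beta> / 2) ^ k * L * (x\<^sup>2 / 4) \<le> q * (x / 2 - x\<^sup>2 / 2 - x * \<delta>) - ln 2"
        using le_num by linarith
      then have "(\<beta> / 2) ^ k * L * (x\<^sup>2 / 4) / ln 4 \<le> (q * (x / 2 - x\<^sup>2 / 2 - x * \<delta>) - ln 2) / ln 4"
        by (rule divide_right_mono) simp
      moreover have "c * L = (\<beta> / 2) ^ k * L * (x\<^sup>2 / 4) / ln 4"
        by (simp add: c_def)
      ultimately show ?thesis by (simp only: q_def)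
    qed
    obtain D where D: "set_pmf D \<subseteq> inputs k m n"
      and ge: "\<forall>\<alpha> R \<delta> x. \<alpha> < 2 \<longrightarrow> 0 \<le> x \<longrightarrow> estimates R k m n \<phi> \<alpha> \<delta> \<longrightarrow>
        ennreal ((real (h ^ k) * (x / 2 - x\<^sup>2 / 2 - x * \<delta>) - ln 2) / ln 4) \<le> expected_space R D"
      using hard_distribution[OF assms(1) h4 1 2 3 4] by (elim exE conjE)
    show ?thesis
    proof (intro exI[of _ D] conjI D allI impI)
      fix \<alpha> :: real and R assume "\<alpha> < 2" "estimates R k m n \<phi> \<alpha> \<delta>"
      with ge x have "ennreal ((real (h ^ k) * (x / 2 - x\<^sup>2 / 2 - x * \<delta>) - ln 2) / ln 4) \<le> expected_space R D"
        by (simp only: less_imp_le)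
      then show "ennreal (c * L) \<le> expected_space R D"
        by (rule order_trans[OF ennreal_leI[OF final]])
    qed
  qed
  show ?thesis
    unfolding Let_def
  proof (rule exI[of _ c], rule conjI[OF c], rule exI[of _ N], intro allI impI)
    fix m n \<phi> :: nat
    let ?L = "min (real m) (min (real n ^ k) ((real m / real \<phi>) ^ k))"
    assume "0 < \<phi>" "N \<le> ?L"
    from main[OF refl this] show "\<exists>D :: nat set list pmf. set_pmf D \<subseteq> inputs k m n \<and>
      (\<forall>\<alpha>::real. \<alpha> < 2 \<longrightarrow> (\<forall>R :: algorithm pmf. estimates R k m n \<phi> \<alpha> \<delta> \<longrightarrow>
        ennreal (c * ?L) \<le> expected_space R D))" .
  qed
qed

end
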